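(* Let $S=\langle g_1,\dots,g_\nu\rangle$ be a numerical semigroup minimally generated by $m=g_1<g_2<\dots<g_\nu$, with Frobenius number $f$. The following conditions are equivalent: (i) $\mathrm{Ap}(S)$ is $\beta$-rectangular; (ii) $\mathrm{Ap}(S)$ has a unique maximal element with respect to $\preceq_M$ and this element has a unique maximal representation; (iii) $S$ is $M$-pure, symmetric and $\mathrm{Ap}(S)$ is of unique maximal expression; (iv) $f+m=\sum_{i=2}^{\nu}\beta_ig_i$; (v) $m=\prod_{i=2}^{\nu}(\beta_i+1)$.
   Context: A numerical semigroup is a submonoid $S$ of $(\mathbb N,+)$, $0\in\mathbb N$, with finite complement in $\mathbb N$. Its multiplicity $m=g_1$ is the least positive element of $S$, and its Frobenius number is $f=\max\{z\in\mathbb Z : z\notin S\}$. The Apéry set is $\mathrm{Ap}(S)=\{\omega\in S : \omega-m\notin S\}$, i.e. the set of smallest elements of $S$ in each congruence class modulo $m$. $S$ is symmetric if for every integer $x$, $f-x\notin S$ implies $x\in S$. Let $M=S\setminus\{0\}$, $hM=M+\dots+M$ ($h$ summands), $0M=S$. The order $\mathrm{ord}(s)$ of $s\in S$ is the unique $h\in\mathbb N$ with $s\in hM\setminus(h+1)M$. For $s,t\in S$, write $s\preceq_M t$ if there is $u\in S$ with $s+u=t$ and $\mathrm{ord}(s)+\mathrm{ord}(u)=\mathrm{ord}(t)$; this is a partial order. $S$ is $M$-pure if all the maximal elements of $\mathrm{Ap}(S)$ with respect to $\preceq_M$ have the same order. A representation of $s\in S$ is an expression $s=\lambda_1g_1+\dots+\lambda_\nu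 g_\nu$ with $\lambda_i\in\mathbb N$; it is maximal if $\lambda_1+\dots+\lambda_\nu=\mathrm{ord}(s)$. $\mathrm{Ap}(S)$ is of unique maximal expression if every $\omega\in\mathrm{Ap}(S)$ has a unique maximal representation. For $i=2,\dots,\nu$ let $\beta_i=\max\{h\in\mathbb N : hg_i\in\mathrm{Ap}(S)\text{ and }\mathrm{ord}(hg_i)=h\}$. Let $B=\{\sum_{i=2}^\nu\lambda_ig_i : 0\le\lambda_i\le\beta_i\}$. $\mathrm{Ap}(S)$ is called $\beta$-rectangular if $\mathrm{Ap}(S)=B$. *)

theory Defs
  imports Main "HOL-Library.FuncSet"
begin

definition numerical_semigroup :: "nat set \<Rightarrow> bool" where
  "numerical_semigroup S \<longleftrightarrow> 0 \<in> S \<and> (\<forall>s\<in>S. \<forall>t\<in>S. s + t \<in> S) \<and> finite (UNIV - S)"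

(* The submonoid of the natural numbers generated by A; used for finite A only. *)
definition sg_span :: "nat set \<Rightarrow> nat set" where
  "sg_span A = {\<Sum>a\<in>A. l a * a | l :: nat \<Rightarrow> nat. True}"

(* The generators are g 1 < ... < g \<nu>; values of g outside {1..\<nu>} are irrelevant. *)
definition minimally_generated :: "nat set \<Rightarrow> (nat \<Rightarrow> nat) \<Rightarrow> nat \<Rightarrow> bool" where
  "minimally_generated S g \<nu> \<longleftrightarrow>
     strict_mono_on {1..\<nu>} g \<and> sg_span (g ` {1..\<nu>}) = S \<and>
     (\<forall>A. A \<subset> g ` {1..\<nu>} \<longrightarrow> sg_span A \<noteq> S)"

definition sg_mult :: "nat set \<Rightarrow> nat" where
  "sg_mult S = (LEAST s. s \<in> S \<and> 0 < s)"

(* Integer-valued: the Frobenius number of the semigroup of all naturals is -1. *)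
definition frobenius :: "nat set \<Rightarrow> int" where
  "frobenius S = (GREATEST z :: int. z \<notin> int ` S)"

(* The difference is an integer one; truncated subtraction would exclude 0. *)
definition Apery :: "nat set \<Rightarrow> nat set" where
  "Apery S = {w \<in> S. int w - int (sg_mult S) \<notin> int ` S}"

definition sg_symmetric :: "nat set \<Rightarrow> bool" where
  "sg_symmetric S \<longleftrightarrow> (\<forall>x :: int. frobenius S - x \<notin> int ` S \<longrightarrow> x \<in> int ` S)"

(* hM for M = S - {0}, with the convention 0M = S *)
definition hfold_M :: "nat set \<Rightarrow> nat \<Rightarrow> nat set" where
  "hfold_M S h = (if h = 0 then S
     else {sum_list xs | xs. length xs = h \<and> set xs \<subseteq> S - {0}})"

definition sg_ord :: "nat set \<Rightarrow> nat \<Rightarrow> nat" where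
  "sg_ord S s = (THE h. s \<in> hfold_M S h - hfold_M S (h + 1))"

definition le_M :: "nat set \<Rightarrow> nat \<Rightarrow> nat \<Rightarrow> bool" where
  "le_M S s t \<longleftrightarrow> (\<exists>u\<in>S. s + u = t \<and> sg_ord S s + sg_ord S u = sg_ord S t)"

definition max_Apery :: "nat set \<Rightarrow> nat set" where
  "max_Apery S = {w \<in> Apery S. \<forall>v\<in>Apery S. le_M S w v \<longrightarrow> v = w}"

definition M_pure :: "nat set \<Rightarrow> bool" where
  "M_pure S \<longleftrightarrow> (\<forall>v\<in>max_Apery S. \<forall>w\<in>max_Apery S. sg_ord S v = sg_ord S w)"

(* Coefficient vectors are extensional functions on {1..\<nu>}, so that counting them is meaningful. *)
definition maximal_reps :: "nat set \<Rightarrow> (nat \<Rightarrow> nat) \<Rightarrow> nat \<Rightarrow> nat \<Rightarrow> (nat \<Rightarrow> nat) set" where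
  "maximal_reps S g \<nu> s = {l \<in> {1..\<nu>} \<rightarrow>\<^sub>E UNIV.
     s = (\<Sum>i=1..\<nu>. l i * g i) \<and> (\<Sum>i=1..\<nu>. l i) = sg_ord S s}"

definition unique_maximal_rep :: "nat set \<Rightarrow> (nat \<Rightarrow> nat) \<Rightarrow> nat \<Rightarrow> nat \<Rightarrow> bool" where
  "unique_maximal_rep S g \<nu> s \<longleftrightarrow> (\<exists>!l. l \<in> maximal_reps S g \<nu> s)"

definition Apery_unique_maximal_expression :: "nat set \<Rightarrow> (nat \<Rightarrow> nat) \<Rightarrow> nat \<Rightarrow> bool" where
  "Apery_unique_maximal_expression S g \<nu> \<longleftrightarrow> (\<forall>w\<in>Apery S. unique_maximal_rep S g \<nu> w)"

definition beta :: "nat set \<Rightarrow> (nat \<Rightarrow> nat) \<Rightarrow> nat \<Rightarrow> nat" where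
  "beta S g i = Max {h. h * g i \<in> Apery S \<and> sg_ord S (h * g i) = h}"

definition beta_rectangular :: "nat set \<Rightarrow> (nat \<Rightarrow> nat) \<Rightarrow> nat \<Rightarrow> bool" where
  "beta_rectangular S g \<nu> \<longleftrightarrow>
     Apery S = {\<Sum>i=2..\<nu>. l i * g i | l. \<forall>i\<in>{2..\<nu>}. l i \<le> beta S g i}"

end

(* A sub-representation of a maximal representation is again maximal. Applied to the multiples
   of single generators, this puts the coefficients of every maximal representation of an Apery
   element below the beta_i, so Ap(S) is always contained in B, and equality holds as soon as
   the top element b = sum of the beta_i g_i lies in Ap(S). When it does, the beta_i form its
   only maximal representation, and an exchange inside this representation shows that the
   representations counted by the product of the beta_i + 1 have distinct values. *)
theory Submission
  imports Defs
begin

section \<open>Representations of semigroup elements by coefficient vectors\<close>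

locale generated_numerical_semigroup =
  fixes S :: "nat set" and g :: "nat \<Rightarrow> nat" and \<nu> :: nat
  assumes numerical: "numerical_semigroup S"
    and generated: "minimally_generated S g \<nu>"
begin

text \<open>Entries outside \<open>{1..\<nu>}\<close> are ignored; extensionality matters only where
  vectors are counted or shown equal.\<close>

definition val :: "(nat \<Rightarrow> nat) \<Rightarrow> nat" where
  "val l = (\<Sum>i=1..\<nu>. l i * g i)"

definition len :: "(nat \<Rightarrow> nat) \<Rightarrow> nat" where
  "len l = (\<Sum>i=1..\<nu>. l i)"

lemma val_cong: "(\<And>i. i \<in> {1..\<nu>} \<Longrightarrow> l i = k i) \<Longrightarrow> val l = val k"
  unfolding val_def by (rule sum.cong) auto

lemma len_cong: "(\<And>i. i \<in> {1..\<nu>} \<Longrightarrow> l i = k i) \<Longrightarrow> len l = len k"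
  unfolding len_def by (rule sum.cong) auto

lemma val_add: "val (\<lambda>i. l i + k i) = val l + val k"
  by (simp add: val_def sum.distrib add_mult_distrib)

lemma len_add: "len (\<lambda>i. l i + k i) = len l + len k"
  by (simp add: len_def sum.distrib)

lemma val_diff:
  assumes "\<And>i. i \<in> {1..\<nu>} \<Longrightarrow> l i \<le> k i"
  shows "val l + val (\<lambda>i. k i - l i) = val k"
  unfolding val_add[symmetric] using assms by (intro val_cong) auto

lemma len_diff:
  assumes "\<And>i. i \<in> {1..\<nu>} \<Longrightarrow> l i \<le> k i"
  shows "len l + len (\<lambda>i. k i - l i) = len k"
  unfolding len_add[symmetric] using assms by (intro len_cong) auto

lemma val_single: "j \<in> {1..\<nu>} \<Longrightarrow> val (\<lambda>i. if i = j then h else 0) = h * g j"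
  by (simp add: val_def if_distrib[of "\<lambda>x. x * _"] sum.delta cong: if_cong)

lemma len_single: "j \<in> {1..\<nu>} \<Longrightarrow> len (\<lambda>i. if i = j then h else 0) = h"
  by (simp add: len_def sum.delta)

lemma zero_in_S: "0 \<in> S"
  and add_in_S: "s \<in> S \<Longrightarrow> t \<in> S \<Longrightarrow> s + t \<in> S"
  and finite_gaps: "finite (UNIV - S)"
  using numerical by (auto simp: numerical_semigroup_def)

lemma strict_mono_g: "strict_mono_on {1..\<nu>} g"
  using generated by (simp add: minimally_generated_def)

lemma inj_on_g: "inj_on g {1..\<nu>}"
  using strict_mono_g by (rule strict_mono_on_imp_inj_on)

lemma S_eq_range_val: "S = range val"
proof -
  have "sg_span (g ` {1..\<nu>}) = range val"
  proof (intro set_eqI iffI)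
    fix s assume "s \<in> sg_span (g ` {1..\<nu>})"
    then obtain l where "s = (\<Sum>a\<in>g ` {1..\<nu>}. l a * a)"
      by (auto simp: sg_span_def)
    then have "s = val (\<lambda>i. l (g i))"
      by (simp add: val_def sum.reindex[OF inj_on_g] del: One_nat_def)
    then show "s \<in> range val" by blast
  next
    fix s assume "s \<in> range val"
    then obtain l where "s = val l" by blast
    \<comment> \<open>The inverse of \<open>g\<close> carries coefficients from indices to
      generators.\<close>
    also have "val l = (\<Sum>a\<in>g ` {1..\<nu>}. (l \<circ> the_inv_into {1..\<nu>} g) a * a)"
      by (simp add: val_def sum.reindex[OF inj_on_g] the_inv_into_f_f[OF inj_on_g] del: One_nat_def)
    finally show "s \<in> sg_span (g ` {1..\<nu>})"
      unfolding sg_span_def by blast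
  qed
  then show ?thesis using generated by (simp add: minimally_generated_def)
qed

lemma val_in_S: "val l \<in> S"
  by (simp add: S_eq_range_val)

text \<open>A generator 0 could be dropped without changing the span, against minimality.\<close>

lemma g_pos:
  assumes "i \<in> {1..\<nu>}" shows "0 < g i"
proof (rule ccontr)
  assume "\<not> 0 < g i"
  let ?G = "g ` {1..\<nu>}"
  have zero: "0 \<in> ?G" using assms \<open>\<not> 0 < g i\<close> by force
  have "(\<Sum>a\<in>?G. l a * a) = (\<Sum>a\<in>?G - {0}. l a * a)" for l :: "nat \<Rightarrow> nat"
    by (rule sum.mono_neutral_right) auto
  then have "sg_span (?G - {0}) = sg_span ?G" by (simp add: sg_span_def)
  moreover have "?G - {0} \<subset> ?G" using zero by blast
  ultimately show False using generated by (simp add: minimally_generated_def)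
qed

text \<open>Without generators \<open>S\<close> would be \<open>{0}\<close>, whose complement is
  infinite.\<close>

lemma rank_pos: "1 \<le> \<nu>"
proof (rule ccontr)
  assume "\<not> 1 \<le> \<nu>"
  then have "S = {0}" by (auto simp: S_eq_range_val val_def)
  then have "finite (UNIV - {0::nat})" using finite_gaps by simp
  then show False by simp
qed

lemma one_in_index: "1 \<in> {1..\<nu>}"
  using rank_pos by simp

lemma g_in_S: "i \<in> {1..\<nu>} \<Longrightarrow> g i \<in> S"
  using val_in_S[of "\<lambda>j. if j = i then 1 else 0"] val_single[of i 1] by simp

lemma g_1_le: "i \<in> {1..\<nu>} \<Longrightarrow> g 1 \<le> g i"
  using strict_mono_onD[OF strict_mono_g, of 1 i] one_in_index by (cases "i = 1") auto

lemma len_le_val: "len l \<le> val l"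
  unfolding len_def val_def using g_pos by (intro sum_mono) (simp add: Suc_leI)

lemma len_pos: "0 < val l \<Longrightarrow> 0 < len l"
  by (auto simp: len_def val_def intro!: Nat.gr0I)

lemma mult_eq: "sg_mult S = g 1"
  unfolding sg_mult_def
proof (rule Least_equality)
  show "g 1 \<in> S \<and> 0 < g 1" using g_in_S g_pos one_in_index by blast
next
  fix s assume "s \<in> S \<and> 0 < s"
  then obtain l where l: "s = val l" "0 < val l" by (auto simp: S_eq_range_val)
  then have "len l \<noteq> 0" using len_pos by blast
  then obtain i where i: "i \<in> {1..\<nu>}" "l i \<noteq> 0"
    unfolding len_def by (meson sum.neutral)
  have "g 1 \<le> l i * g i" using g_1_le[OF i(1)] i(2) by (cases "l i") auto
  also have "\<dots> \<le> val l" unfolding val_def using i(1) by (intro member_le_sum) auto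
  finally show "g 1 \<le> s" using l by simp
qed

lemma mult_in_S: "sg_mult S \<in> S" and mult_pos: "0 < sg_mult S"
  using mult_eq g_in_S[OF one_in_index] g_pos[OF one_in_index] by auto

lemma mult_times_in_S: "k * sg_mult S \<in> S"
  by (induction k) (auto simp: zero_in_S intro: add_in_S mult_in_S)

subsection \<open>The order as maximal length of a representation\<close>

text \<open>A positive summand has only representations of positive length, so adding
  representations of the summands uses at least one generator per summand.\<close>

lemma sum_list_rep:
  "set xs \<subseteq> S - {0} \<Longrightarrow> \<exists>l. val l = sum_list xs \<and> length xs \<le> len l"
proof (induction xs)
  case Nil
  show ?case by (rule exI[of _ "\<lambda>_. 0"]) (simp add: val_def)
next
  case (Cons x xs)
  then obtain l where l: "val l = sum_list xs" "length xs \<le> len l" by auto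
  obtain k where k: "x = val k" "0 < x" using Cons.prems by (auto simp: S_eq_range_val)
  then have "0 < len k" using len_pos by simp
  then show ?case using l k
    by (intro exI[of _ "\<lambda>i. k i + l i"]) (simp add: val_add len_add)
qed

text \<open>Generators are split off one at a time and the last summand absorbs the rest. Starting
  at \<open>Suc h\<close> avoids the empty list, whose sum is only 0 although
  \<open>hfold_M S 0\<close> is \<open>S\<close>.\<close>

lemma rep_sum_list:
  "Suc h \<le> len l \<Longrightarrow> \<exists>xs. length xs = Suc h \<and> set xs \<subseteq> S - {0} \<and> sum_list xs = val l"
proof (induction h arbitrary: l)
  case 0
  then have "0 < val l" using len_le_val[of l] by simp
  then show ?case using val_in_S by (intro exI[of _ "[val l]"]) auto
next
  case (Suc h)
  then have "len l \<noteq> 0" by simp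
  then obtain j where j: "j \<in> {1..\<nu>}" "l j \<noteq> 0"
    unfolding len_def by (meson sum.neutral)
  define e where "e = (\<lambda>i. if i = j then 1 else 0 :: nat)"
  have e: "val e = g j" "len e = 1"
    using val_single[OF j(1), of 1] len_single[OF j(1), of 1] by (simp_all add: e_def)
  have le: "e i \<le> l i" for i using j(2) by (simp add: e_def)
  have "Suc h \<le> len (\<lambda>i. l i - e i)"
    using len_diff[of e l] le e(2) Suc.prems by simp
  then obtain xs where "length xs = Suc h" "set xs \<subseteq> S - {0}"
    "sum_list xs = val (\<lambda>i. l i - e i)"
    using Suc.IH by blast
  then show ?case
    using val_diff[of e l] le e(1) g_in_S[OF j(1)] g_pos[OF j(1)]
    by (intro exI[of _ "g j # xs"]) auto
qed

lemma hfold_M_iff: "s \<in> hfold_M S h \<longleftrightarrow> (\<exists>l. val l = s \<and> h \<le> len l)"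
proof (cases h)
  case 0
  then show ?thesis by (auto simp: hfold_M_def S_eq_range_val)
next
  case (Suc n)
  then have "s \<in> hfold_M S h \<longleftrightarrow>
      (\<exists>xs. length xs = Suc n \<and> set xs \<subseteq> S - {0} \<and> sum_list xs = s)"
    by (auto simp: hfold_M_def)
  also have "\<dots> \<longleftrightarrow> (\<exists>l. val l = s \<and> h \<le> len l)"
    using sum_list_rep rep_sum_list[of n] Suc by metis
  finally show ?thesis .
qed

text \<open>Representations of \<open>s\<close> have length at most \<open>s\<close>, as generators
  are positive. By \<open>hfold_M_iff\<close>, \<open>s\<close> lies in hM exactly for h up to the
  largest length, so the order is that maximum.\<close>

lemma ord_props:
  assumes "s \<in> S"
  shows "\<exists>l. val l = s \<and> len l = sg_ord S s"
    and "val k = s \<Longrightarrow> len k \<le> sg_ord S s"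
proof -
  let ?H = "{len l | l. val l = s}"
  have "?H \<subseteq> {..s}" using len_le_val by auto
  then have fin: "finite ?H" by (rule finite_subset) simp
  have ne: "?H \<noteq> {}" using assms by (auto simp: S_eq_range_val)
  have iff: "s \<in> hfold_M S h \<longleftrightarrow> h \<le> Max ?H" for h
    using Max_ge_iff[OF fin ne] by (auto simp: hfold_M_iff)
  have ord: "sg_ord S s = Max ?H"
    unfolding sg_ord_def by (rule the_equality) (auto simp only: iff Diff_iff)
  show "\<exists>l. val l = s \<and> len l = sg_ord S s"
    using Max_in[OF fin ne] unfolding ord by auto
  show "val k = s \<Longrightarrow> len k \<le> sg_ord S s"
    unfolding ord using fin by (intro Max_ge) auto
qed

lemma maximal_repE:
  assumes "s \<in> S"
  obtains l where "val l = s" "len l = sg_ord S s"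
  using ord_props(1)[OF assms] by blast

lemma len_le_ord: "len l \<le> sg_ord S (val l)"
  using ord_props(2)[OF val_in_S] by blast

text \<open>Maximal representations of the summands add up to a representation of the sum, which
  need not be maximal.\<close>

lemma ord_add_le:
  assumes "s \<in> S" "t \<in> S"
  shows "sg_ord S s + sg_ord S t \<le> sg_ord S (s + t)"
proof -
  obtain l where "val l = s" "len l = sg_ord S s" using assms(1) by (rule maximal_repE)
  moreover obtain k where "val k = t" "len k = sg_ord S t" using assms(2) by (rule maximal_repE)
  ultimately show ?thesis using len_le_ord[of "\<lambda>i. l i + k i"] by (simp add: val_add len_add)
qed

lemma ord_0: "sg_ord S 0 = 0"
  using ord_add_le[OF zero_in_S zero_in_S] by simp

lemma ord_eq_0: "s \<in> S \<Longrightarrow> sg_ord S s = 0 \<Longrightarrow> s = 0"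
  by (metis maximal_repE len_pos bot_nat_0.not_eq_extremum)

text \<open>The two complementary parts have lengths at most their orders, and these orders add up
  to at most the order of the whole. The lengths already add up to that order, so equality holds
  throughout.\<close>

lemma sub_rep_maximal:
  assumes "len k = sg_ord S (val k)" "\<And>i. i \<in> {1..\<nu>} \<Longrightarrow> l i \<le> k i"
  shows "sg_ord S (val l) = len l"
    and "sg_ord S (val l) + sg_ord S (val (\<lambda>i. k i - l i)) = sg_ord S (val k)"
  using len_diff[of l k] val_diff[of l k] assms len_le_ord[of l]
    len_le_ord[of "\<lambda>i. k i - l i"]
    ord_add_le[OF val_in_S val_in_S, of l "\<lambda>i. k i - l i"]
  by auto

text \<open>The witnesses add up; superadditivity for \<open>a + b\<close> and for
  \<open>s + (a + b)\<close> gives the two inequalities between the orders.\<close>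

lemma le_M_trans:
  assumes "s \<in> S" "le_M S s t" "le_M S t u"
  shows "le_M S s u"
proof -
  obtain a b where ab: "a \<in> S" "b \<in> S" "s + a = t" "t + b = u"
    "sg_ord S s + sg_ord S a = sg_ord S t" "sg_ord S t + sg_ord S b = sg_ord S u"
    using assms(2,3) by (auto simp: le_M_def)
  have u: "s + (a + b) = u" using ab by simp
  have "sg_ord S s + sg_ord S (a + b) \<le> sg_ord S u"
    using ord_add_le[of s "a + b"] assms(1) add_in_S[of a b] ab(1,2) unfolding u by blast
  then have "sg_ord S s + sg_ord S (a + b) = sg_ord S u"
    using ord_add_le[OF ab(1,2)] ab(5,6) by linarith
  then show ?thesis using u ab add_in_S[of a b] by (auto simp: le_M_def)
qed

subsection \<open>The Apery set\<close>

lemma Apery_iff: "w \<in> Apery S \<longleftrightarrow> w \<in> S \<and> (\<forall>s\<in>S. s + sg_mult S \<noteq> w)"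
proof -
  have "int w - int (sg_mult S) \<in> int ` S \<longleftrightarrow> (\<exists>s\<in>S. s + sg_mult S = w)"
    by (force simp: image_iff)
  then show ?thesis by (auto simp: Apery_def)
qed

lemma Apery_in_S: "w \<in> Apery S \<Longrightarrow> w \<in> S"
  by (simp add: Apery_iff)

text \<open>If the multiplicity could be subtracted from \<open>s\<close> within \<open>S\<close>,
  it could be subtracted from \<open>s + t\<close> as well.\<close>

lemma Apery_summand:
  assumes "s + t \<in> Apery S" "s \<in> S" "t \<in> S"
  shows "s \<in> Apery S"
  using assms add_in_S by (fastforce simp: Apery_iff)

lemma Apery_sub_rep:
  assumes "val k \<in> Apery S" "\<And>i. i \<in> {1..\<nu>} \<Longrightarrow> l i \<le> k i"
  shows "val l \<in> Apery S"
proof (rule Apery_summand[OF _ val_in_S val_in_S])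
  show "val l + val (\<lambda>i. k i - l i) \<in> Apery S"
    using assms val_diff[of l k] by simp
qed

text \<open>\<open>g 1\<close> is the multiplicity, so a copy of it could be removed within
  \<open>S\<close>.\<close>

lemma Apery_rep_1:
  assumes "val l \<in> Apery S" shows "l 1 = 0"
proof (rule ccontr)
  assume "l 1 \<noteq> 0"
  define e where "e = (\<lambda>i :: nat. if i = 1 then 1 else 0 :: nat)"
  have "val e = sg_mult S"
    using val_single[OF one_in_index, of 1] by (simp add: e_def mult_eq)
  moreover have "val e + val (\<lambda>i. l i - e i) = val l"
    using \<open>l 1 \<noteq> 0\<close> by (intro val_diff) (simp add: e_def)
  ultimately show False
    using assms val_in_S by (metis Apery_iff add.commute)
qed

lemma zero_in_Apery: "0 \<in> Apery S"
  using zero_in_S mult_pos by (simp add: Apery_iff)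

text \<open>Reduction modulo the multiplicity maps the Apery set bijectively onto the
  residues.\<close>

lemma card_Apery: "card (Apery S) = sg_mult S"
proof -
  let ?m = "sg_mult S"
  have no_less: False
    if vw: "v \<in> Apery S" "w \<in> Apery S" "v mod ?m = w mod ?m" "v < w" for v w
  proof -
    obtain k where k: "w = v + k * ?m"
      using vw(3,4) by (metis le_add_diff_inverse less_imp_le mod_eq_dvd_iff_nat dvd_div_mult_self)
    with vw(4) obtain n where "k = Suc n" by (cases k) auto
    \<comment> \<open>Removing one copy of \<open>?m\<close> from \<open>w\<close> leaves
      \<open>v\<close> plus further copies, which is still in \<open>S\<close>.\<close>
    then have "(v + n * ?m) + ?m = w" using k by simp
    moreover have "v + n * ?m \<in> S"
      using vw(1) by (intro add_in_S mult_times_in_S Apery_in_S)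
    ultimately show False using vw(2) by (auto simp: Apery_iff)
  qed
  then have inj: "inj_on (\<lambda>w. w mod ?m) (Apery S)"
    by (metis (no_types, lifting) inj_onI linorder_neqE_nat)
  have "r \<in> (\<lambda>w. w mod ?m) ` Apery S" if "r < ?m" for r
  proof -
    have "\<exists>s\<in>S. s mod ?m = r"
    proof (rule ccontr)
      assume none: "\<not> (\<exists>s\<in>S. s mod ?m = r)"
      \<comment> \<open>A residue class disjoint from \<open>S\<close> would give infinitely many
        gaps.\<close>
      have "range (\<lambda>k. r + k * ?m) \<subseteq> UNIV - S" using none that by auto
      moreover have "inj (\<lambda>k. r + k * ?m)" using mult_pos by (auto simp: inj_def)
      ultimately show False
        using finite_gaps by (metis finite_subset finite_imageD infinite_UNIV_nat)
    qed
    then have ex: "\<exists>s. s \<in> S \<and> s mod ?m = r" by blast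
    define w where "w = (LEAST s. s \<in> S \<and> s mod ?m = r)"
    have w: "w \<in> S" "w mod ?m = r" using LeastI_ex[OF ex] by (simp_all add: w_def)
    have "s + ?m \<noteq> w" if "s \<in> S" for s
    proof
      assume s: "s + ?m = w"
      then have "s mod ?m = r" using w(2) by auto
      then have "w \<le> s" using that unfolding w_def by (intro Least_le) simp
      then show False using s mult_pos by simp
    qed
    then have "w \<in> Apery S" using w by (auto simp: Apery_iff)
    then show ?thesis using w by blast
  qed
  then have "(\<lambda>w. w mod ?m) ` Apery S = {..<?m}" using mult_pos by auto
  then show ?thesis using card_image[OF inj] by simp
qed

lemma finite_Apery: "finite (Apery S)"
  using card_Apery mult_pos card_gt_0_iff by metis

section \<open>The Frobenius number and the maximal Apery elements\<close>

lemma frobenius_props: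
  shows "frobenius S \<notin> int ` S" and "z \<notin> int ` S \<Longrightarrow> z \<le> frobenius S"
proof -
  obtain N where N: "\<And>n. n \<notin> S \<Longrightarrow> n \<le> N"
    using finite_gaps by (metis DiffI UNIV_I finite_nat_set_iff_bounded_le)
  have bound: "z \<le> int N" if "z \<notin> int ` S" for z
  proof (cases "0 \<le> z")
    case True
    then have "nat z \<notin> S" using that by (metis image_eqI nat_0_le)
    then show ?thesis using N[of "nat z"] by simp
  qed simp
  \<comment> \<open>A finite window holding the maximum; -1 keeps it nonempty even when
    \<open>S\<close> has no gaps.\<close>
  let ?Z = "{z. z \<notin> int ` S} \<inter> {-1..int N}"
  have "-1 \<in> ?Z" by auto
  then have ne: "?Z \<noteq> {}" by blast
  have fin: "finite ?Z" by simp
  have "Max ?Z \<notin> int ` S" using Max_in[OF fin ne] by blast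
  moreover have "z \<le> Max ?Z" if "z \<notin> int ` S" for z
  proof (cases "-1 \<le> z")
    case True
    then show ?thesis using bound that fin by (intro Max_ge) auto
  next
    case False
    then show ?thesis using Max_ge[OF fin \<open>-1 \<in> ?Z\<close>] by linarith
  qed
  ultimately have "frobenius S = Max ?Z"
    unfolding frobenius_def by (intro Greatest_equality) auto
  with \<open>Max ?Z \<notin> int ` S\<close> \<open>\<And>z. z \<notin> int ` S \<Longrightarrow> z \<le> Max ?Z\<close>
  show "frobenius S \<notin> int ` S" "z \<notin> int ` S \<Longrightarrow> z \<le> frobenius S" by auto
qed

text \<open>With m the multiplicity, f + m exceeds f and so lies in \<open>S\<close>, while f does
  not. For any Apery element w, the integer w - m is missing from \<open>S\<close>, hence at most
  f.\<close>

lemma frobenius_eq_Max_Apery: "frobenius S + int (sg_mult S) = int (Max (Apery S))"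
proof -
  have "frobenius S + int (sg_mult S) \<in> int ` S"
    using frobenius_props(2) mult_pos by fastforce
  then obtain F where F: "F \<in> S" "frobenius S + int (sg_mult S) = int F" by blast
  then have "int F - int (sg_mult S) \<notin> int ` S"
    using frobenius_props(1) by (metis add_diff_cancel_right')
  with F have "F \<in> Apery S" by (simp add: Apery_def)
  moreover have "w \<le> F" if "w \<in> Apery S" for w
    using that frobenius_props(2)[of "int w - int (sg_mult S)"] F(2)
    by (auto simp: Apery_def)
  ultimately have "Max (Apery S) = F" by (intro Max_eqI finite_Apery)
  then show ?thesis using F by simp
qed

text \<open>Among the finitely many Apery elements above \<open>v\<close> the numerically largest is
  maximal, because \<open>le_M\<close> implies \<le>.\<close>

lemma le_M_maximal:
  assumes "v \<in> Apery S"
  obtains w where "w \<in> max_Apery S" "le_M S v w"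
proof -
  let ?U = "{w \<in> Apery S. le_M S v w}"
  have "v \<in> ?U" using assms zero_in_S ord_0 by (auto simp: le_M_def)
  then have ne: "?U \<noteq> {}" by blast
  have fin: "finite ?U" using finite_Apery by simp
  define w where "w = Max ?U"
  have w: "w \<in> Apery S" "le_M S v w" using Max_in[OF fin ne] by (simp_all add: w_def)
  have "u = w" if "u \<in> Apery S" "le_M S w u" for u
  proof -
    have "u \<in> ?U" using that w le_M_trans Apery_in_S[OF assms] by blast
    then have "u \<le> w" using fin by (simp add: w_def)
    moreover have "w \<le> u" using that(2) by (auto simp: le_M_def)
    ultimately show ?thesis by simp
  qed
  then show ?thesis using w that by (auto simp: max_Apery_def)
qed

lemma maximal_reps_iff:
  "l \<in> maximal_reps S g \<nu> s \<longleftrightarrow>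
     l \<in> extensional {1..\<nu>} \<and> val l = s \<and> len l = sg_ord S s"
  by (auto simp: maximal_reps_def val_def len_def PiE_UNIV_domain PiE_def)

subsection \<open>The box of the exponents\<close>

(* Setting the first bound to 0 lets boxes be indexed by {1..\<nu>}, like representations. *)
definition bound :: "nat \<Rightarrow> nat" where
  "bound i = (if i = 1 then 0 else beta S g i)"

definition box :: "(nat \<Rightarrow> nat) set" where
  "box = (\<Pi>\<^sub>E i\<in>{1..\<nu>}. {..bound i})"

lemma index_split: "{1..\<nu>} = insert 1 {2..\<nu>}"
  using rank_pos by auto

lemma val_bound: "val bound = (\<Sum>i=2..\<nu>. beta S g i * g i)"
  unfolding val_def index_split by (auto simp: bound_def intro!: sum.cong)

lemma card_box: "card box = (\<Prod>i=2..\<nu>. beta S g i + 1)"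
proof -
  have "card box = (\<Prod>i=1..\<nu>. bound i + 1)"
    unfolding box_def by (simp add: card_PiE)
  also have "\<dots> = (\<Prod>i=2..\<nu>. beta S g i + 1)"
    unfolding index_split by (auto simp: bound_def intro!: prod.cong)
  finally show ?thesis .
qed

lemma finite_box: "finite box"
  unfolding box_def by (intro finite_PiE) auto

lemma box_le_bound: "l \<in> box \<Longrightarrow> i \<in> {1..\<nu>} \<Longrightarrow> l i \<le> bound i"
  unfolding box_def by blast

lemma val_box_iff: "s \<in> val ` box \<longleftrightarrow> (\<exists>l. val l = s \<and> (\<forall>i\<in>{1..\<nu>}. l i \<le> bound i))"
proof
  assume "\<exists>l. val l = s \<and> (\<forall>i\<in>{1..\<nu>}. l i \<le> bound i)"
  then obtain l where l: "val l = s" "\<forall>i\<in>{1..\<nu>}. l i \<le> bound i" by blast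
  then have "restrict l {1..\<nu>} \<in> box" by (auto simp: box_def)
  moreover have "val (restrict l {1..\<nu>}) = s" using l(1) val_cong[of "restrict l {1..\<nu>}" l] by simp
  ultimately show "s \<in> val ` box" by blast
next
  assume "s \<in> val ` box"
  then show "\<exists>l. val l = s \<and> (\<forall>i\<in>{1..\<nu>}. l i \<le> bound i)"
    unfolding box_def by blast
qed

lemma beta_rectangular_iff_box: "beta_rectangular S g \<nu> \<longleftrightarrow> Apery S = val ` box"
proof -
  have "{\<Sum>i=2..\<nu>. l i * g i | l. \<forall>i\<in>{2..\<nu>}. l i \<le> beta S g i} = val ` box" (is "?B = _")
  proof (intro set_eqI iffI)
    fix s assume "s \<in> ?B"
    then obtain l where l: "s = (\<Sum>i=2..\<nu>. l i * g i)" "\<forall>i\<in>{2..\<nu>}. l i \<le> beta S g i" by blast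
    \<comment> \<open>The sums in \<open>?B\<close> start at index 2, so the entry of
      \<open>l\<close> at 1 is arbitrary and has to be reset.\<close>
    have "val (l(1 := 0)) = s"
      unfolding val_def index_split using l(1) by (auto intro!: sum.cong)
    moreover have "\<forall>i\<in>{1..\<nu>}. (l(1 := 0)) i \<le> bound i"
      using l(2) by (auto simp: bound_def)
    ultimately show "s \<in> val ` box" unfolding val_box_iff by blast
  next
    fix s assume "s \<in> val ` box"
    then obtain l where l: "val l = s" "\<forall>i\<in>{1..\<nu>}. l i \<le> bound i" unfolding val_box_iff by blast
    then have "l 1 = 0" using one_in_index by (force simp: bound_def)
    then have "s = (\<Sum>i=2..\<nu>. l i * g i)"
      using l(1) unfolding val_def index_split by simp
    moreover have "\<forall>i\<in>{2..\<nu>}. l i \<le> beta S g i" using l(2) unfolding index_split bound_def by auto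
    ultimately show "s \<in> ?B" by blast
  qed
  then show ?thesis by (simp add: beta_rectangular_def)
qed

text \<open>Makes the \<open>Max\<close> in \<open>beta\<close> meaningful: as \<open>g i\<close> is
  positive, distinct multipliers give distinct elements of the finite Apery set.\<close>

lemma finite_beta_set:
  assumes "i \<in> {1..\<nu>}" shows "finite {h. h * g i \<in> Apery S \<and> sg_ord S (h * g i) = h}"
proof (rule finite_imageD)
  show "finite ((\<lambda>h. h * g i) ` {h. h * g i \<in> Apery S \<and> sg_ord S (h * g i) = h})"
    by (rule finite_subset[OF _ finite_Apery]) auto
  show "inj_on (\<lambda>h. h * g i) {h. h * g i \<in> Apery S \<and> sg_ord S (h * g i) = h}"
    using g_pos[OF assms] by (auto simp: inj_on_def)
qed

lemma beta_attained:
  assumes "i \<in> {1..\<nu>}"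
  shows "beta S g i * g i \<in> Apery S" "sg_ord S (beta S g i * g i) = beta S g i"
proof -
  have "0 \<in> {h. h * g i \<in> Apery S \<and> sg_ord S (h * g i) = h}" using zero_in_Apery ord_0 by simp
  then have "beta S g i \<in> {h. h * g i \<in> Apery S \<and> sg_ord S (h * g i) = h}"
    unfolding beta_def using finite_beta_set[OF assms] by (intro Max_in) blast+
  then show "beta S g i * g i \<in> Apery S" "sg_ord S (beta S g i * g i) = beta S g i" by auto
qed

text \<open>The part of \<open>l\<close> at the single index \<open>i\<close> is a
  sub-representation of a maximal one, so \<open>l i\<close> is among the numbers whose maximum is
  \<open>beta S g i\<close>.\<close>

lemma maximal_rep_le_bound:
  assumes "val l \<in> Apery S" "len l = sg_ord S (val l)" "i \<in> {1..\<nu>}"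
  shows "l i \<le> bound i"
proof (cases "i = 1")
  case True
  then show ?thesis using Apery_rep_1[OF assms(1)] by simp
next
  case False
  let ?e = "\<lambda>j. if j = i then l i else 0"
  have le: "?e j \<le> l j" for j by simp
  have "val ?e \<in> Apery S" using assms(1) le by (rule Apery_sub_rep)
  moreover have "sg_ord S (val ?e) = len ?e" using assms(2) le by (rule sub_rep_maximal)
  ultimately have "l i \<in> {h. h * g i \<in> Apery S \<and> sg_ord S (h * g i) = h}"
    using val_single[OF assms(3)] len_single[OF assms(3)] by simp
  then show ?thesis
    using finite_beta_set[OF assms(3)] False by (simp add: bound_def beta_def)
qed

lemma Apery_subset_box: "Apery S \<subseteq> val ` box"
proof
  fix w assume w: "w \<in> Apery S"
  obtain l where "val l = w" "len l = sg_ord S w" using Apery_in_S[OF w] by (rule maximal_repE)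
  then show "w \<in> val ` box"
    using maximal_rep_le_bound[of l] w unfolding val_box_iff by auto
qed

section \<open>The top element \<open>val bound\<close> and its consequences\<close>

lemma val_le_mono: "(\<And>i. i \<in> {1..\<nu>} \<Longrightarrow> l i \<le> k i) \<Longrightarrow> val l \<le> val k"
  using val_diff[of l k] by simp

lemma val_eq_imp_eq:
  assumes "\<And>i. i \<in> {1..\<nu>} \<Longrightarrow> l i \<le> k i" "val l = val k" "i \<in> {1..\<nu>}"
  shows "l i = k i"
proof -
  have "l i * g i = k i * g i"
    using assms(2) unfolding val_def
    by (rule sum_mono_inv) (use assms in auto)
  then show ?thesis using g_pos[OF assms(3)] by simp
qed

text \<open>Every vector of \<open>box\<close> is a sub-representation of \<open>bound\<close>, and
  summands of Apery elements are Apery; the other inclusion always holds.\<close>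

lemma beta_rectangular_iff_top: "beta_rectangular S g \<nu> \<longleftrightarrow> val bound \<in> Apery S"
proof
  assume "beta_rectangular S g \<nu>"
  then show "val bound \<in> Apery S"
    unfolding beta_rectangular_iff_box by (auto simp only: val_box_iff)
next
  assume "val bound \<in> Apery S"
  then have "val ` box \<subseteq> Apery S"
    using Apery_sub_rep[of bound] box_le_bound by blast
  then show "beta_rectangular S g \<nu>"
    using Apery_subset_box by (simp add: beta_rectangular_iff_box)
qed

text \<open>A maximal representation of the top element stays below \<open>bound\<close> and has the
  same value, so it is \<open>bound\<close> itself on \<open>{1..\<nu>}\<close>.\<close>

lemma len_bound:
  assumes "val bound \<in> Apery S"
  shows "len bound = sg_ord S (val bound)"
proof -
  obtain l where l: "val l = val bound" "len l = sg_ord S (val bound)"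
    using val_in_S by (rule maximal_repE)
  then have "l i \<le> bound i" if "i \<in> {1..\<nu>}" for i
    using maximal_rep_le_bound[of l i] that assms by simp
  then have "l i = bound i" if "i \<in> {1..\<nu>}" for i
    using val_eq_imp_eq[of l bound i] l(1) that by simp
  then show ?thesis using len_cong[of l bound] l(2) by simp
qed

(* Exchange: replacing k by l inside the top representation gives another maximal
   representation of the top element, which is again bounded by the box. *)
lemma box_rep_le:
  assumes top: "val bound \<in> Apery S" and "k \<in> box" "l \<in> box" "val k = val l" "i \<in> {1..\<nu>}"
  shows "l i \<le> k i"
proof -
  note k = box_le_bound[OF assms(2)] and l = box_le_bound[OF assms(3)]
  \<comment> \<open>Both are sub-representations of the maximal representation \<open>bound\<close>,
    so each length is the order of the common value.\<close>
  have "len k = len l"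
    using sub_rep_maximal(1)[OF len_bound[OF top], of k] sub_rep_maximal(1)[OF len_bound[OF top], of l]
      k l assms(4) by simp
  let ?n = "\<lambda>i. l i + (bound i - k i)"
  have "val ?n = val bound"
    using val_diff[of k bound] k assms(4) by (simp add: val_add)
  moreover have "len ?n = len bound"
    using len_diff[of k bound] k \<open>len k = len l\<close> by (simp add: len_add)
  ultimately have "?n i \<le> bound i"
    using maximal_rep_le_bound[of ?n i] top len_bound[OF top] assms(5) by simp
  then show ?thesis using k[OF assms(5)] by simp
qed

lemma inj_on_val_box:
  assumes "val bound \<in> Apery S" shows "inj_on val box"
proof (rule inj_onI)
  fix k l assume kl: "k \<in> box" "l \<in> box" "val k = val l"
  show "k = l"
  proof (rule PiE_ext[OF kl(1)[unfolded box_def] kl(2)[unfolded box_def]])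
    fix i assume "i \<in> {1..\<nu>}"
    then show "k i = l i"
      using box_rep_le[OF assms kl] box_rep_le[OF assms kl(2,1) kl(3)[symmetric]]
      by (intro antisym) auto
  qed
qed

lemma top_unique_expression:
  assumes top: "val bound \<in> Apery S"
  shows "Apery_unique_maximal_expression S g \<nu>"
  unfolding Apery_unique_maximal_expression_def unique_maximal_rep_def
proof
  fix w assume w: "w \<in> Apery S"
  obtain l where l: "val l = w" "len l = sg_ord S w" using Apery_in_S[OF w] by (rule maximal_repE)
  show "\<exists>!l. l \<in> maximal_reps S g \<nu> w"
  proof (rule ex_ex1I)
    have "restrict l {1..\<nu>} \<in> maximal_reps S g \<nu> w"
      using l val_cong[of "restrict l {1..\<nu>}" l] len_cong[of "restrict l {1..\<nu>}" l]
      by (simp add: maximal_reps_iff)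
    then show "\<exists>l. l \<in> maximal_reps S g \<nu> w" by blast
  next
    fix k k' assume k: "k \<in> maximal_reps S g \<nu> w" "k' \<in> maximal_reps S g \<nu> w"
    \<comment> \<open>Maximal representations of Apery elements lie in \<open>box\<close>, where
      \<open>val\<close> is injective.\<close>
    have "k \<in> box" "k' \<in> box"
      using k maximal_rep_le_bound w by (auto simp: maximal_reps_iff box_def PiE_def)
    then show "k = k'"
      using k inj_on_val_box[OF top] by (auto simp: maximal_reps_iff inj_on_def)
  qed
qed

text \<open>An Apery element is the value of some \<open>l\<close> in \<open>box\<close>; the
  complement of \<open>l\<close> in \<open>bound\<close> witnesses that it lies below the top
  element.\<close>

lemma top_max_Apery:
  assumes top: "val bound \<in> Apery S"
  shows "max_Apery S = {val bound}"
proof -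
  have below: "le_M S w (val bound) \<and> w \<le> val bound" if "w \<in> Apery S" for w
  proof -
    from that obtain l where l: "w = val l" "l \<in> box" using Apery_subset_box by blast
    note le = box_le_bound[OF l(2)]
    have "le_M S (val l) (val bound)"
      unfolding le_M_def
      using val_diff[of l bound] sub_rep_maximal(2)[OF len_bound[OF top], of l] le val_in_S by blast
    then show ?thesis using l val_le_mono[of l bound] le by simp
  qed
  have "v = val bound" if "v \<in> Apery S" "le_M S (val bound) v" for v
    using that below[of v] by (auto simp: le_M_def)
  then show ?thesis
    using below top by (auto simp: max_Apery_def)
qed

text \<open>Symmetry of \<open>S\<close> about f becomes invariance of the Apery set under
  reflection in its largest element.\<close>

lemma symmetric_iff_Apery:
  "sg_symmetric S \<longleftrightarrow> (\<forall>w\<in>Apery S. \<exists>v\<in>S. w + v = Max (Apery S))"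
proof
  assume sym: "sg_symmetric S"
  show "\<forall>w\<in>Apery S. \<exists>v\<in>S. w + v = Max (Apery S)"
  proof
    fix w assume w: "w \<in> Apery S"
    have "frobenius S - (int (Max (Apery S)) - int w) = int w - int (sg_mult S)"
      using frobenius_eq_Max_Apery by linarith
    moreover have "int w - int (sg_mult S) \<notin> int ` S" using w by (simp add: Apery_def)
    ultimately have "frobenius S - (int (Max (Apery S)) - int w) \<notin> int ` S" by metis
    then have "int (Max (Apery S)) - int w \<in> int ` S"
      using sym unfolding sg_symmetric_def by blast
    then show "\<exists>v\<in>S. w + v = Max (Apery S)" by force
  qed
next
  assume refl: "\<forall>w\<in>Apery S. \<exists>v\<in>S. w + v = Max (Apery S)"
  let ?m = "sg_mult S"
  have "frobenius S - x \<in> int ` S" if x: "x \<notin> int ` S" for x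
  proof -
    have ex: "\<exists>n. x + int n * int ?m \<in> int ` S"
    proof -
      obtain n where "x + int n * int ?m > frobenius S"
      proof
        \<comment> \<open>The multiplicity is at least 1, so this many copies pass f; truncation by
          \<open>nat\<close> can only increase the count.\<close>
        have "int (nat (frobenius S - x + 1)) * 1 \<le> int (nat (frobenius S - x + 1)) * int ?m"
          using mult_pos by (intro mult_left_mono) auto
        then show "frobenius S < x + int (nat (frobenius S - x + 1)) * int ?m" by linarith
      qed
      then show ?thesis using frobenius_props(2) by (meson not_le)
    qed
    \<comment> \<open>The first translate of \<open>x\<close> to enter \<open>S\<close> is an Apery
      element; \<open>n\<close> is positive because \<open>x\<close> itself is outside. Reflecting
      that element gives \<open>v\<close>, and f - x is \<open>v\<close> plus n - 1 copies of
      \<open>?m\<close>.\<close>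
    define n where "n = (LEAST n. x + int n * int ?m \<in> int ` S)"
    have n: "x + int n * int ?m \<in> int ` S" using LeastI_ex[OF ex] by (simp add: n_def)
    then obtain p where p: "n = Suc p" using x by (cases n) auto
    have "x + int p * int ?m \<notin> int ` S"
      using not_less_Least[of p "\<lambda>n. x + int n * int ?m \<in> int ` S"] p n_def by simp
    moreover obtain w where w: "w \<in> S" "int w = x + int n * int ?m" using n by auto
    ultimately have "w \<in> Apery S" by (simp add: Apery_def p algebra_simps)
    then obtain v where v: "v \<in> S" "w + v = Max (Apery S)" using refl by blast
    have "frobenius S - x = int (v + p * ?m)"
      using frobenius_eq_Max_Apery v(2)[symmetric] w(2) by (simp add: p algebra_simps)
    then show ?thesis using add_in_S[OF v(1) mult_times_in_S] by blast
  qed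
  then show "sg_symmetric S" unfolding sg_symmetric_def by blast
qed

lemma top_eq_Max:
  assumes "val bound \<in> Apery S" shows "Max (Apery S) = val bound"
proof (rule Max_eqI[OF finite_Apery _ assms])
  fix w assume "w \<in> Apery S"
  then obtain l where "w = val l" "l \<in> box" using Apery_subset_box by blast
  then show "w \<le> val bound" using val_le_mono box_le_bound by blast
qed

lemma top_symmetric:
  assumes top: "val bound \<in> Apery S" shows "sg_symmetric S"
  unfolding symmetric_iff_Apery top_eq_Max[OF top]
proof
  fix w assume "w \<in> Apery S"
  then obtain l where "w = val l" "l \<in> box" using Apery_subset_box by blast
  then show "\<exists>v\<in>S. w + v = val bound"
    using val_diff[of l bound] box_le_bound val_in_S by blast
qed

text \<open>Each \<open>beta S g i * g i\<close> lies below \<open>w\<close>, so some maximal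
  representation of \<open>w\<close> uses \<open>g i\<close> at least that often. By uniqueness it
  is always the same \<open>l\<close>, which therefore dominates \<open>bound\<close>.\<close>

lemma unique_maximal_imp_top:
  assumes max: "max_Apery S = {w}" and rep: "unique_maximal_rep S g \<nu> w"
  shows "val bound \<in> Apery S"
proof -
  obtain l where l: "l \<in> maximal_reps S g \<nu> w"
    and uniq: "\<And>k. k \<in> maximal_reps S g \<nu> w \<Longrightarrow> k = l"
    using rep unfolding unique_maximal_rep_def by blast
  have "bound i \<le> l i" if i: "i \<in> {1..\<nu>}" for i
  proof (cases "i = 1")
    case False
    let ?b = "beta S g i"
    obtain w' where "w' \<in> max_Apery S" "le_M S (?b * g i) w'"
      using beta_attained(1)[OF i] by (rule le_M_maximal)
    then have "le_M S (?b * g i) w" using max by simp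
    then obtain u where u: "u \<in> S" "?b * g i + u = w" "?b + sg_ord S u = sg_ord S w"
      using beta_attained(2)[OF i] by (auto simp: le_M_def)
    obtain k where k: "val k = u" "len k = sg_ord S u" using u(1) by (rule maximal_repE)
    \<comment> \<open>The \<open>?b\<close> copies of \<open>g i\<close> together with a maximal
      representation of the complement \<open>u\<close>; the orders add up, so the result is maximal
      for \<open>w\<close>.\<close>
    let ?k = "\<lambda>j. (if j = i then ?b else 0) + k j"
    have "val ?k = w" "len ?k = sg_ord S w"
      unfolding val_add len_add using val_single[OF i] len_single[OF i] k u by simp_all
    then have "restrict ?k {1..\<nu>} \<in> maximal_reps S g \<nu> w"
      using val_cong[of "restrict ?k {1..\<nu>}" ?k] len_cong[of "restrict ?k {1..\<nu>}" ?k]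
      by (simp add: maximal_reps_iff)
    then have "restrict ?k {1..\<nu>} = l" by (rule uniq)
    then have "restrict ?k {1..\<nu>} i = l i" by (rule fun_cong)
    then show ?thesis using False i by (simp add: bound_def)
  qed (simp add: bound_def)
  moreover have "val l \<in> Apery S" using l max by (auto simp: maximal_reps_iff max_Apery_def)
  ultimately show ?thesis using Apery_sub_rep by blast
qed

text \<open>Symmetry completes a maximal \<open>w\<close> to the largest Apery element by some
  \<open>v\<close>. Purity makes the orders of \<open>w\<close> and of that element equal, so
  \<open>v\<close> has order 0 by superadditivity and vanishes.\<close>

lemma pure_symmetric_imp_max_Apery:
  assumes pure: "M_pure S" and sym: "sg_symmetric S"
  shows "max_Apery S = {Max (Apery S)}"
proof -
  let ?F = "Max (Apery S)"
  have F: "?F \<in> Apery S" using finite_Apery zero_in_Apery by (intro Max_in) auto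
  have F_max: "?F \<in> max_Apery S"
    unfolding max_Apery_def using F finite_Apery by (auto simp: le_M_def intro: antisym[OF Max_ge])
  moreover have "w = ?F" if w: "w \<in> max_Apery S" for w
  proof -
    have wA: "w \<in> Apery S" using w by (simp add: max_Apery_def)
    then obtain v where v: "v \<in> S" "w + v = ?F" using sym symmetric_iff_Apery by blast
    have "sg_ord S w = sg_ord S ?F" using pure w F_max unfolding M_pure_def by blast
    then have "sg_ord S v = 0" using ord_add_le[OF Apery_in_S[OF wA] v(1)] v(2) by simp
    then have "v = 0" using ord_eq_0 v(1) by blast
    then show ?thesis using v(2) by simp
  qed
  ultimately show ?thesis by blast
qed

section \<open>The four equivalences\<close>

lemma beta_rectangular_iff_unique_maximal:
  "beta_rectangular S g \<nu> \<longleftrightarrow> (\<exists>w. max_Apery S = {w} \<and> unique_maximal_rep S g \<nu> w)"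
  unfolding beta_rectangular_iff_top
  using top_max_Apery top_unique_expression unique_maximal_imp_top
  unfolding Apery_unique_maximal_expression_def by blast

lemma beta_rectangular_iff_pure_symmetric:
  "beta_rectangular S g \<nu> \<longleftrightarrow>
     M_pure S \<and> sg_symmetric S \<and> Apery_unique_maximal_expression S g \<nu>"
proof
  assume "beta_rectangular S g \<nu>"
  then have top: "val bound \<in> Apery S" by (simp only: beta_rectangular_iff_top)
  then show "M_pure S \<and> sg_symmetric S \<and> Apery_unique_maximal_expression S g \<nu>"
    using top_max_Apery top_symmetric top_unique_expression by (simp add: M_pure_def)
next
  assume R: "M_pure S \<and> sg_symmetric S \<and> Apery_unique_maximal_expression S g \<nu>"
  then have max: "max_Apery S = {Max (Apery S)}" using pure_symmetric_imp_max_Apery by blast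
  then have "Max (Apery S) \<in> Apery S" by (auto simp: max_Apery_def)
  then have "unique_maximal_rep S g \<nu> (Max (Apery S))"
    using R by (simp add: Apery_unique_maximal_expression_def)
  then show "beta_rectangular S g \<nu>"
    using max beta_rectangular_iff_unique_maximal by blast
qed

text \<open>The left side is the largest Apery element, and \<open>val bound\<close> is that element
  as soon as it lies in the Apery set.\<close>

lemma beta_rectangular_iff_frobenius:
  "beta_rectangular S g \<nu> \<longleftrightarrow>
     frobenius S + int (sg_mult S) = int (\<Sum>i=2..\<nu>. beta S g i * g i)"
  unfolding beta_rectangular_iff_top frobenius_eq_Max_Apery val_bound[symmetric] of_nat_eq_iff
  using top_eq_Max Max_in[OF finite_Apery] zero_in_Apery by (metis empty_iff)

text \<open>The product counts \<open>box\<close> and the multiplicity counts the Apery set; in the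
  rectangular case \<open>val\<close> is a bijection between them.\<close>

lemma beta_rectangular_iff_mult:
  "beta_rectangular S g \<nu> \<longleftrightarrow> sg_mult S = (\<Prod>i=2..\<nu>. beta S g i + 1)"
  unfolding card_box[symmetric] card_Apery[symmetric]
proof
  assume "beta_rectangular S g \<nu>"
  then show "card (Apery S) = card box"
    using beta_rectangular_iff_box beta_rectangular_iff_top inj_on_val_box card_image by metis
next
  assume "card (Apery S) = card box"
  \<comment> \<open>The image of \<open>box\<close> contains the Apery set and has at most
    \<open>card box\<close> elements, so equal cardinalities force equality.\<close>
  then have "card (val ` box) \<le> card (Apery S)" using card_image_le[OF finite_box] by simp
  then have "Apery S = val ` box"
    using Apery_subset_box finite_box by (intro card_seteq) auto
  then show "beta_rectangular S g \<nu>" by (simp add: beta_rectangular_iff_box)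
qed

end

theorem theorem2p16:
  fixes S :: "nat set" and g :: "nat \<Rightarrow> nat" and \<nu> :: nat
  assumes "numerical_semigroup S"
    and "minimally_generated S g \<nu>"
  shows
    "(beta_rectangular S g \<nu> \<longleftrightarrow>
        (\<exists>w. max_Apery S = {w} \<and> unique_maximal_rep S g \<nu> w)) \<and>
     (beta_rectangular S g \<nu> \<longleftrightarrow>
        M_pure S \<and> sg_symmetric S \<and> Apery_unique_maximal_expression S g \<nu>) \<and>
     (beta_rectangular S g \<nu> \<longleftrightarrow>
        frobenius S + int (sg_mult S) = int (\<Sum>i=2..\<nu>. beta S g i * g i)) \<and>
     (beta_rectangular S g \<nu> \<longleftrightarrow>
        sg_mult S = (\<Prod>i=2..\<nu>. beta S g i + 1))"
proof -
  interpret generated_numerical_semigroup S g \<nu>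
    using assms by unfold_locales
  show ?thesis
    using beta_rectangular_iff_unique_maximal beta_rectangular_iff_pure_symmetric
      beta_rectangular_iff_frobenius beta_rectangular_iff_mult by blast
qed

end
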